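(* Let $p\geq 5$ be a prime and let $N\geq 1$ be an integer. Then $$\mathrm{N}(\mathrm{P}(\mathrm{C}_{p^{N}}))-1\equiv \frac{1}{p}\left\{\binom{2p-1}{p-1}-1\right\} \pmod{p^{3}}.$$ Consequently, $$\mathrm{N}(\mathrm{P}(\mathrm{C}_{p^{N}}))\equiv 1 \pmod{p^{3}} \iff p \text{ is a Wolstenholme prime}.$$
   Context: For a finite group $G$, take independent commuting variables $x_g$ ($g\in G$) and let $M(G):=(x_{gh^{-1}})_{g,h\in G}$ be the group matrix. The group permanent is $\mathrm{P}(G):=\mathrm{perm}(M(G))=\sum_{\sigma}\prod_{g\in G}x_{g\sigma(g)^{-1}}\in\mathbb{Z}[x_g : g\in G]$, where $\sigma$ runs over all permutations of the set $G$. For a polynomial $f$, $\mathrm{N}(f)$ denotes the number of distinct monomials with nonzero coefficient in $f$. $\mathrm{C}_n$ denotes the cyclic group of order $n$. A prime $p$ is called a Wolstenholme prime if $\binom{2p-1}{p-1}\equiv 1\pmod{p^4}$. The quantity $\frac1p\{\binom{2p-1}{p-1}-1\}$ is an integer by Wolstenholme's theorem. *)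

theory Defs
  imports
    Complex_Main
    "HOL-Algebra.Elementary_Groups"
    "HOL-Combinatorics.Permutations"
    "HOL-Library.Poly_Mapping"
    "HOL-Number_Theory.Cong"
    "HOL-Computational_Algebra.Primes"
begin

text \<open>
  The ring \<open>\<int>[x\<^sub>g : g]\<close> with variables indexed by \<open>'a\<close>: a monomial is a finitely supported
  exponent function \<open>'a \<Rightarrow>\<^sub>0 nat\<close>, and the product of \<^typ>\<open>('a \<Rightarrow>\<^sub>0 nat) \<Rightarrow>\<^sub>0 int\<close> is convolution,
  i.e. polynomial multiplication.
\<close>
type_synonym 'a int_mpoly = "('a \<Rightarrow>\<^sub>0 nat) \<Rightarrow>\<^sub>0 int"

definition mpoly_var :: "'a \<Rightarrow> 'a int_mpoly" where
  "mpoly_var g = Poly_Mapping.single (Poly_Mapping.single g 1) 1"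

definition num_monomials :: "'a int_mpoly \<Rightarrow> nat" where
  "num_monomials f = card (Poly_Mapping.keys f)"

definition perm_on :: "'a set \<Rightarrow> ('a \<Rightarrow> 'a \<Rightarrow> 'r::comm_semiring_1) \<Rightarrow> 'r" where
  "perm_on A M = (\<Sum>\<sigma> | \<sigma> permutes A. \<Prod>g\<in>A. M g (\<sigma> g))"

definition group_matrix :: "('a, 'b) monoid_scheme \<Rightarrow> 'a \<Rightarrow> 'a \<Rightarrow> 'a int_mpoly" where
  "group_matrix G g h = mpoly_var (g \<otimes>\<^bsub>G\<^esub> inv\<^bsub>G\<^esub> h)"

definition group_permanent :: "('a, 'b) monoid_scheme \<Rightarrow> 'a int_mpoly" where
  "group_permanent G = perm_on (carrier G) (group_matrix G)"

definition wolstenholme_prime :: "nat \<Rightarrow> bool" where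
  "wolstenholme_prime p \<longleftrightarrow> prime p \<and> [(2 * p - 1) choose (p - 1) = 1] (mod p ^ 4)"

end

theory Submission
  imports Defs "HOL-Number_Theory.Totient" "HOL-Computational_Algebra.Polynomial_FPS"
begin

text \<open>
  Let \<open>n = p ^ N\<close>. Expanding the permanent of the cyclic group of order \<open>n\<close> gives one monomial for every
  permutation \<open>\<sigma>\<close> of the residues, namely the one that belongs to the multiset of the differences
  \<open>g - \<sigma> g\<close>. All coefficients are positive, so the number of monomials is the number of multisets that
  arise in this way. By a theorem of Marshall Hall (\<open>Hall_differences\<close>) these are exactly the multisets
  of \<open>n\<close> residues whose sum is zero: starting from any permutation, its differences can be exchanged one
  after the other for prescribed ones, until only the last remains, which the sum determines.

  The multisets with sum zero are counted with a roots-of-unity filter (\<open>card_zero_sum_multisets\<close>). The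
  generating function of multisets of residues, evaluated at a root of unity of order \<open>d\<close>, is
  \<open>(1 - X ^ d) ^ (- (n / d))\<close>; averaging its \<open>n\<close>-th coefficient over all \<open>n\<close>-th roots of unity expresses
  the number of multisets by the binomials \<open>c k = (2 * p ^ k - 1) choose (p ^ k - 1)\<close>. For a prime power
  the average telescopes, so that the number of monomials is \<open>1\<close> plus the sum of
  \<open>(c k - c (k - 1)) / p ^ k\<close> for \<open>1 \<le> k \<le> N\<close>.

  Finally \<open>c k\<close> and \<open>c (k - 1)\<close> agree modulo \<open>p ^ (3 * k)\<close>, a version of Wolstenholme's theorem for prime
  powers (\<open>central_binomial_prime_power_cong\<close>). Thus the summand for \<open>k\<close> is divisible by \<open>p ^ (2 * k)\<close>, and
  modulo \<open>p ^ 3\<close>, even modulo \<open>p ^ 4\<close>, only \<open>(c 1 - 1) / p\<close> is left. It vanishes modulo \<open>p ^ 3\<close> exactly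
  if \<open>c 1 = 1\<close> modulo \<open>p ^ 4\<close>.
\<close>

section \<open>Differences of permutations and Hall's theorem\<close>

definition differences :: "int \<Rightarrow> (int \<Rightarrow> int) \<Rightarrow> int multiset" where
  "differences n \<sigma> = image_mset (\<lambda>y. (y - \<sigma> y) mod n) (mset_set {0..<n})"

text \<open>
  Only the arguments at which two maps disagree matter for comparing their differences. Adding
  the terms for \<open>T\<close> on both sides avoids the truncated subtraction of multisets.
\<close>

lemma differences_change:
  assumes "T \<subseteq> {0..<n}" and "\<And>y. y \<in> {0..<n} - T \<Longrightarrow> \<sigma> y = \<tau> y"
  shows "differences n \<sigma> + image_mset (\<lambda>y. (y - \<tau> y) mod n) (mset_set T)
       = differences n \<tau> + image_mset (\<lambda>y. (y - \<sigma> y) mod n) (mset_set T)"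
proof -
  have "finite T" using assms(1) finite_subset by blast
  then have split: "mset_set {0..<n} = mset_set ({0..<n} - T) + mset_set T"
    using assms(1) by (subst mset_set_Union [symmetric]) (auto simp: Un_absorb2)
  have "image_mset (\<lambda>y. (y - \<sigma> y) mod n) (mset_set ({0..<n} - T))
      = image_mset (\<lambda>y. (y - \<tau> y) mod n) (mset_set ({0..<n} - T))"
    using assms(2) by (intro image_mset_cong) auto
  then show ?thesis
    by (simp add: differences_def split add_ac)
qed

text \<open>
  A permutation of the residues followed by the reflection \<open>x \<mapsto> K - x\<close> is again injective on residues.
  This is what keeps the walk in the next lemma from visiting an argument twice.
\<close>

lemma diff_permuted_cong_iff:
  fixes n K :: int
  assumes "\<sigma> permutes {0..<n}" "u \<in> {0..<n}" "v \<in> {0..<n}"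
  shows "(K - \<sigma> u) mod n = (K - \<sigma> v) mod n \<longleftrightarrow> u = v"
proof
  assume "(K - \<sigma> u) mod n = (K - \<sigma> v) mod n"
  then have "n dvd (K - \<sigma> u) - (K - \<sigma> v)" by (simp only: mod_eq_dvd_iff)
  then have "n dvd \<sigma> v - \<sigma> u" by simp
  then have "\<sigma> v mod n = \<sigma> u mod n" by (simp add: mod_eq_dvd_iff)
  moreover have "\<sigma> u \<in> {0..<n}" "\<sigma> v \<in> {0..<n}"
    using assms permutes_in_image[OF assms(1)] by blast+
  ultimately have "\<sigma> v = \<sigma> u" by simp
  then show "u = v" using permutes_inj[OF assms(1)] by (auto simp: inj_eq)
qed simp

text \<open>
  The rematching step behind Hall's theorem. The goal is to give up the two differences of \<open>\<sigma>\<close> at \<open>Y1\<close>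
  and \<open>Y2\<close> in exchange for the difference \<open>b\<close> and one further difference \<open>c\<close>, leaving the multiset of
  differences otherwise unchanged. The value \<open>\<sigma> Y1\<close> yields the difference \<open>b\<close> when it is placed at
  \<open>y = \<sigma> Y1 + b = K - \<sigma> Y2\<close>. If \<open>y\<close> is \<open>Y1\<close> or \<open>Y2\<close>, nothing else is affected. Otherwise the value
  \<open>\<sigma> y\<close> is displaced and its difference is lost; rotating the values of \<open>y\<close>, \<open>Y1\<close>, \<open>Y2\<close> gives a
  permutation that faces the same problem with the lost difference in the role of \<open>b\<close> and, crucially,
  with the same \<open>K\<close>.

  Since \<open>K\<close> does not change, the places \<open>y\<close> met in this way form the orbit of one map,
  \<open>y \<mapsto> K - \<sigma> y\<close> for the initial \<open>\<sigma>\<close>. That map is injective modulo \<open>n\<close>, so the orbit cannot close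
  up before it reaches \<open>Y1\<close> or \<open>Y2\<close>. The set \<open>W\<close> records this: it contains the next place, and the map
  sends every point of \<open>W\<close> other than \<open>Y1\<close> and \<open>Y2\<close> into \<open>W\<close>, but never back to the next place. Each
  step removes one point from \<open>W\<close>.
\<close>

lemma exchange_differences_along_path:
  fixes n b K :: int
  assumes "\<sigma> permutes {0..<n}"
    and "Y1 \<in> {0..<n}" "Y2 \<in> {0..<n}" "Y1 \<noteq> Y2"
    and "finite W" "W \<subseteq> {0..<n}"
    and "(K - \<sigma> Y2) mod n \<in> W"
    and "\<And>y. y \<in> W - {Y1, Y2} \<Longrightarrow> (K - \<sigma> y) mod n \<in> W - {(K - \<sigma> Y2) mod n}"
    and "[K = \<sigma> Y1 + \<sigma> Y2 + b] (mod n)"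
  shows "\<exists>\<tau> c. \<tau> permutes {0..<n} \<and>
     differences n \<tau> + {#(Y1 - \<sigma> Y1) mod n, (Y2 - \<sigma> Y2) mod n#} = differences n \<sigma> + {#b mod n, c#}"
  using assms(5,1-4,6-)
proof (induction "card W" arbitrary: W \<sigma> b rule: less_induct)
  case less
  note perm = less.prems(2) and Y = less.prems(3-5) and W = less.prems(1,6)
    and start = less.prems(7) and step = less.prems(8) and K = less.prems(9)
  define y where "y = (K - \<sigma> Y2) mod n"
  have "[K - \<sigma> Y2 = \<sigma> Y1 + \<sigma> Y2 + b - \<sigma> Y2] (mod n)"
    using K by (intro cong_diff) auto
  then have y_eq: "y = (\<sigma> Y1 + b) mod n"
    by (simp add: y_def cong_def)
  have b_eq: "(y - \<sigma> Y1) mod n = b mod n"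
    by (simp add: y_eq mod_diff_left_eq)
  have y_in: "y \<in> W" "y \<in> {0..<n}"
    using start W by (auto simp: y_def)
  consider "y = Y1" | "y = Y2" | "y \<noteq> Y1" "y \<noteq> Y2" by blast
  then show ?case
  proof cases
    case 1
    then show ?thesis
      using perm b_eq by (intro exI[of _ \<sigma>] exI[of _ "(Y2 - \<sigma> Y2) mod n"]) simp
  next
    case 2
    define \<tau> where "\<tau> = \<sigma> \<circ> transpose Y1 Y2"
    have "\<tau> permutes {0..<n}"
      unfolding \<tau>_def using perm Y by (intro permutes_compose permutes_swap_id)
    moreover have "differences n \<tau> + {#(Y1 - \<sigma> Y1) mod n, (Y2 - \<sigma> Y2) mod n#}
        = differences n \<sigma> + {#b mod n, (Y1 - \<sigma> Y2) mod n#}"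
      using differences_change[of "{Y1, Y2}" n \<tau> \<sigma>] Y b_eq 2
      by (auto simp: \<tau>_def transpose_def add_mset_commute)
    ultimately show ?thesis by blast
  next
    case 3
    \<comment> \<open>The rotation places \<open>\<sigma> Y1\<close> at \<open>y\<close>, \<open>\<sigma> Y2\<close> at \<open>Y1\<close> and the displaced \<open>\<sigma> y\<close> at \<open>Y2\<close>.\<close>
    define \<tau> where "\<tau> = \<sigma> \<circ> (transpose y Y1 \<circ> transpose Y1 Y2)"
    have \<tau>_perm: "\<tau> permutes {0..<n}"
      unfolding \<tau>_def using perm Y y_in by (intro permutes_compose permutes_swap_id)
    have \<tau>: "\<tau> y = \<sigma> Y1" "\<tau> Y1 = \<sigma> Y2" "\<tau> Y2 = \<sigma> y" "\<And>z. z \<notin> {y, Y1, Y2} \<Longrightarrow> \<tau> z = \<sigma> z"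
      using 3 Y by (auto simp: \<tau>_def transpose_def)
    have swap: "differences n \<tau> + {#(y - \<sigma> y) mod n, (Y1 - \<sigma> Y1) mod n, (Y2 - \<sigma> Y2) mod n#}
        = differences n \<sigma> + {#b mod n, (Y1 - \<tau> Y1) mod n, (Y2 - \<tau> Y2) mod n#}"
      using differences_change[of "{y, Y1, Y2}" n \<tau> \<sigma>] 3 Y b_eq y_in \<tau> by auto
    have "\<exists>\<tau>' c. \<tau>' permutes {0..<n} \<and>
        differences n \<tau>' + {#(Y1 - \<tau> Y1) mod n, (Y2 - \<tau> Y2) mod n#}
          = differences n \<tau> + {#(y - \<sigma> y) mod n, c#}"
    proof (rule less.hyps[of "W - {y}"])
      show "card (W - {y}) < card W"
        using W y_in by (meson card_Diff1_less)
      show "finite (W - {y})" "W - {y} \<subseteq> {0..<n}" using W by auto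
      show "(K - \<tau> Y2) mod n \<in> W - {y}"
        using step[of y] 3 y_in by (simp add: \<tau> y_def)
      show "(K - \<tau> z) mod n \<in> W - {y} - {(K - \<tau> Y2) mod n}" if "z \<in> W - {y} - {Y1, Y2}" for z
        proof -
        have z: "z \<in> {0..<n}" "z \<noteq> y" "z \<in> W - {Y1, Y2}" "z \<notin> {y, Y1, Y2}"
          using that W by blast+
        have "(K - \<sigma> z) mod n \<in> W - {y}"
          using step[OF z(3)] unfolding y_def .
        moreover have "(K - \<sigma> z) mod n \<noteq> (K - \<sigma> y) mod n"
          using diff_permuted_cong_iff[OF perm z(1) y_in(2)] z(2) by blast
        ultimately show ?thesis
          unfolding \<tau>(3) \<tau>(4)[OF z(4)] by blast
      qed
      have "[K = y + \<sigma> Y2] (mod n)"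
        unfolding y_def by (simp add: cong_def mod_simps)
      then show "[K = \<tau> Y1 + \<tau> Y2 + (y - \<sigma> y)] (mod n)"
        by (simp add: \<tau> algebra_simps)
    qed (use \<tau>_perm Y in auto)
    then obtain \<tau>' c where \<tau>': "\<tau>' permutes {0..<n}"
      and rec: "differences n \<tau>' + {#(Y1 - \<tau> Y1) mod n, (Y2 - \<tau> Y2) mod n#}
          = differences n \<tau> + {#(y - \<sigma> y) mod n, c#}" by blast
    \<comment> \<open>The lost difference and the new differences at \<open>Y1\<close> and \<open>Y2\<close> occur on both sides and cancel.\<close>
    have combine: "(D'' + {#c1, c2#}) + {#d, e1, e2#} = (D + {#b', c#}) + {#d, e1, e2#}"
      if "D' + {#d, c1, c2#} = D + {#b', e1, e2#}" "D'' + {#e1, e2#} = D' + {#d, c#}"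
      for D D' D'' :: "int multiset" and b' c c1 c2 d e1 e2
    proof -
      have "(D'' + {#c1, c2#}) + {#d, e1, e2#} = (D'' + {#e1, e2#}) + {#d, c1, c2#}" by simp
      also have "\<dots> = (D' + {#d, c1, c2#}) + {#d, c#}" unfolding that(2) by simp
      also have "\<dots> = (D + {#b', c#}) + {#d, e1, e2#}" unfolding that(1) by simp
      finally show ?thesis .
    qed
    from swap rec have "(differences n \<tau>' + {#(Y1 - \<sigma> Y1) mod n, (Y2 - \<sigma> Y2) mod n#})
          + {#(y - \<sigma> y) mod n, (Y1 - \<tau> Y1) mod n, (Y2 - \<tau> Y2) mod n#}
        = (differences n \<sigma> + {#b mod n, c#})
          + {#(y - \<sigma> y) mod n, (Y1 - \<tau> Y1) mod n, (Y2 - \<tau> Y2) mod n#}"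
      by (rule combine)
    then have "differences n \<tau>' + {#(Y1 - \<sigma> Y1) mod n, (Y2 - \<sigma> Y2) mod n#}
        = differences n \<sigma> + {#b mod n, c#}"
      by (rule add_right_imp_eq)
    with \<tau>' show ?thesis by blast
  qed
qed

text \<open>
  At the start every residue is still available: the only argument that \<open>y \<mapsto> K - \<sigma> y\<close> sends to the
  first place \<open>K - \<sigma> Y2\<close> is \<open>Y2\<close> itself.
\<close>

lemma exchange_differences:
  fixes n b :: int
  assumes "\<sigma> permutes {0..<n}" "Y1 \<in> {0..<n}" "Y2 \<in> {0..<n}" "Y1 \<noteq> Y2"
  shows "\<exists>\<tau> c. \<tau> permutes {0..<n} \<and>
     differences n \<tau> + {#(Y1 - \<sigma> Y1) mod n, (Y2 - \<sigma> Y2) mod n#} = differences n \<sigma> + {#b mod n, c#}"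
proof (rule exchange_differences_along_path[where W = "{0..<n}" and K = "\<sigma> Y1 + \<sigma> Y2 + b"])
  let ?K = "\<sigma> Y1 + \<sigma> Y2 + b"
  show "(?K - \<sigma> y) mod n \<in> {0..<n} - {(?K - \<sigma> Y2) mod n}" if "y \<in> {0..<n} - {Y1, Y2}" for y
    using that diff_permuted_cong_iff[OF assms(1) _ assms(3), of y ?K] by simp
qed (use assms in auto)

text \<open>
  Fewer than \<open>n\<close> differences can be prescribed at will. As long as at most \<open>n - 2\<close> of them are already
  realised, two differences of the current permutation are unconstrained, and these can be exchanged
  for the next prescribed one.
\<close>

lemma differences_extend:
  assumes "set_mset B \<subseteq> {0..<n}" "int (size B) < n"
  shows "\<exists>\<sigma>. \<sigma> permutes {0..<n} \<and> B \<subseteq># differences n \<sigma>"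
  using assms
proof (induction B)
  case empty
  then show ?case using permutes_id by (intro exI[of _ id]) (simp add: permutes_id del: id_apply)
next
  case (add b B)
  then obtain \<sigma> where \<sigma>: "\<sigma> permutes {0..<n}" "B \<subseteq># differences n \<sigma>" by auto
  let ?d = "\<lambda>y. (y - \<sigma> y) mod n"
  obtain R where R: "differences n \<sigma> = B + R" using \<sigma>(2) by (auto simp: mset_subset_eq_exists_conv)
  have "size (differences n \<sigma>) = nat n" by (simp add: differences_def)
  with R add.prems have "size R \<ge> Suc (Suc 0)" by auto
  then obtain c1 c2 R' where "R = add_mset c1 (add_mset c2 R')"
    by (metis Suc_le_D size_eq_Suc_imp_eq_union size_Suc_Diff1 Suc_le_mono size_eq_Suc_imp_elem insert_DiffM
        size_add_mset nat.inject)
  with R have eq: "image_mset ?d (mset_set {0..<n}) = add_mset c1 (add_mset c2 (B + R'))"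
    by (simp add: differences_def)
  then obtain Y1 A1 where 1: "mset_set {0..<n} = add_mset Y1 A1" "?d Y1 = c1" "image_mset ?d A1 = add_mset c2 (B + R')"
    using msed_map_invR[OF eq] by auto
  then obtain Y2 A2 where 2: "A1 = add_mset Y2 A2" "?d Y2 = c2"
    using msed_map_invR[OF 1(3)] by auto
  have ms: "mset_set {0..<n} = add_mset Y1 (add_mset Y2 A2)" using 1 2 by simp
  have "Y1 \<in># mset_set {0..<n}" "Y2 \<in># mset_set {0..<n}" by (simp_all add: ms)
  moreover have "Y1 \<noteq> Y2"
  proof
    assume "Y1 = Y2"
    then have "count (mset_set {0..<n}) Y1 \<ge> 2" by (simp add: ms)
    moreover have "count (mset_set {0..<n}) Y1 \<le> 1" by (simp add: count_mset_set')
    ultimately show False by simp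
  qed
  ultimately obtain \<tau> c where \<tau>: "\<tau> permutes {0..<n}"
      "differences n \<tau> + {#c1, c2#} = differences n \<sigma> + {#b mod n, c#}"
    using exchange_differences[OF \<sigma>(1), of Y1 Y2 b] 1(2) 2(2) by auto
  moreover have "b mod n = b" using add.prems by auto
  ultimately have "differences n \<tau> + {#c1, c2#} = (add_mset c (add_mset b B) + R') + {#c1, c2#}"
    using eq by (simp add: differences_def)
  then have "differences n \<tau> = add_mset c (add_mset b B) + R'" by (rule add_right_imp_eq)
  then show ?case using \<tau>(1) by (intro exI[of _ \<tau>]) auto
qed

lemma sum_differences_cong_0:
  assumes "\<sigma> permutes {0..<n}"
  shows "[sum_mset (differences n \<sigma>) = 0] (mod n)"
proof -
  have "[(\<Sum>y\<in>{0..<n}. (y - \<sigma> y) mod n) = (\<Sum>y\<in>{0..<n}. y - \<sigma> y)] (mod n)"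
    by (rule cong_sum) (simp add: cong_def)
  moreover have "(\<Sum>y\<in>{0..<n}. y - \<sigma> y) = 0"
    using sum.permute[OF assms, of id] by (simp add: sum_subtractf)
  ultimately show ?thesis by (simp add: differences_def sum_unfold_sum_mset)
qed

text \<open>
  Marshall Hall's theorem for cyclic groups. The differences of a permutation sum to zero because both
  \<open>y\<close> and \<open>\<sigma> y\<close> run through all residues. Conversely, all but one element of a multiset with sum zero
  can be prescribed, and the sum determines the last one.
\<close>

theorem Hall_differences:
  assumes "n > 0"
  shows "differences n ` {\<sigma>. \<sigma> permutes {0..<n}}
       = {B \<in> multisets_of_size {0..<n} (nat n). [sum_mset B = 0] (mod n)}"
proof (intro equalityI subsetI)
  fix B assume "B \<in> differences n ` {\<sigma>. \<sigma> permutes {0..<n}}"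
  then show "B \<in> {B \<in> multisets_of_size {0..<n} (nat n). [sum_mset B = 0] (mod n)}"
    using assms sum_differences_cong_0 by (auto simp: multisets_of_size_def differences_def)
next
  fix B assume "B \<in> {B \<in> multisets_of_size {0..<n} (nat n). [sum_mset B = 0] (mod n)}"
  then have B: "set_mset B \<subseteq> {0..<n}" "size B = nat n" "[sum_mset B = 0] (mod n)"
    by (auto simp: multisets_of_size_def)
  obtain c B' where c: "B = add_mset c B'"
    using B(2) assms by (cases B) auto
  obtain \<sigma> where \<sigma>: "\<sigma> permutes {0..<n}" "B' \<subseteq># differences n \<sigma>"
  proof -
    have "set_mset B' \<subseteq> {0..<n}" "int (size B') < n" using B(1,2) c assms by auto
    then show ?thesis using differences_extend that by blast
  qed
  \<comment> \<open>The single difference that remains has to be \<open>c\<close>, since both multisets have sum zero.\<close>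
  obtain R where R: "differences n \<sigma> = B' + R" using \<sigma>(2) by (auto simp: mset_subset_eq_exists_conv)
  have "size R = 1"
    using arg_cong[OF R, of size] B(2) c by (simp add: differences_def)
  then obtain c' where c': "R = {#c'#}" using size_1_singleton_mset by blast
  have "[sum_mset B = sum_mset (differences n \<sigma>)] (mod n)"
    using B(3) sum_differences_cong_0[OF \<sigma>(1)] cong_sym cong_trans by blast
  then have "[c = c'] (mod n)"
    by (simp add: c R c' add.commute[of _ c'] cong_add_rcancel)
  moreover have "c' \<in># differences n \<sigma>" by (simp add: R c')
  then have "c' \<in> {0..<n}" using assms by (auto simp: differences_def)
  moreover have "c \<in> {0..<n}" using B c by auto
  ultimately have "c = c'" by (simp add: cong_def)
  then show "B \<in> differences n ` {\<sigma>. \<sigma> permutes {0..<n}}"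
  proof -
    have "B = differences n \<sigma>" using R c c' \<open>c = c'\<close> by simp
    then show ?thesis using \<sigma>(1) by blast
  qed
qed

section \<open>Monomials of the group permanent of a cyclic group\<close>

definition monomial_of_mset :: "'a multiset \<Rightarrow> 'a \<Rightarrow>\<^sub>0 nat" where
  "monomial_of_mset B = (\<Sum>i\<in>#B. Poly_Mapping.single i 1)"

lemma lookup_monomial_of_mset: "Poly_Mapping.lookup (monomial_of_mset B) i = count B i"
  unfolding monomial_of_mset_def
  by (induction B) (simp_all add: lookup_add lookup_single when_def)

lemma inj_monomial_of_mset: "inj monomial_of_mset"
  by (rule injI) (metis lookup_monomial_of_mset multiset_eqI)

lemma prod_mpoly_var:
  assumes "finite A"
  shows "(\<Prod>g\<in>A. mpoly_var (f g))
       = Poly_Mapping.single (monomial_of_mset (image_mset f (mset_set A))) 1"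
  using assms
  by (induction A) (simp_all add: monomial_of_mset_def mpoly_var_def mult_single)

text \<open>
  The coefficient of a monomial counts its occurrences; it is positive, so nothing cancels.
\<close>

lemma keys_sum_monomials:
  assumes "finite S"
  shows "Poly_Mapping.keys (\<Sum>s\<in>S. Poly_Mapping.single (m s) (1::int)) = m ` S"
proof -
  have "Poly_Mapping.lookup (\<Sum>s\<in>S. Poly_Mapping.single (m s) (1::int)) k = int (card {s \<in> S. m s = k})" for k
    using assms by (simp add: lookup_sum lookup_single when_def sum.If_cases Int_def eq_commute[of k])
  then show ?thesis
    using assms by (auto simp: set_eq_iff in_keys_iff card_eq_0_iff)
qed

lemma num_monomials_group_permanent_cyclic:
  assumes "n > 0"
  shows "num_monomials (group_permanent (integer_mod_group n))
       = card (differences (int n) ` {\<sigma>. \<sigma> permutes {0..<int n}})"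
proof -
  let ?Z = "{0..<int n}"
  let ?G = "integer_mod_group n"
  have carrier: "carrier ?G = ?Z" using assms by (simp add: carrier_integer_mod_group)
  have entry: "(\<Prod>g\<in>?Z. group_matrix ?G g (\<sigma> g))
      = Poly_Mapping.single (monomial_of_mset (differences (int n) \<sigma>)) 1" if "\<sigma> permutes ?Z" for \<sigma>
  proof -
    have "group_matrix ?G g (\<sigma> g) = mpoly_var ((g - \<sigma> g) mod int n)" if "g \<in> ?Z" for g
    proof -
      have "\<sigma> g \<in> carrier ?G" using \<open>\<sigma> permutes ?Z\<close> that carrier by (simp add: permutes_in_image del: atLeastLessThan_iff)
      then show ?thesis by (simp add: group_matrix_def mod_simps)
    qed
    then have "(\<Prod>g\<in>?Z. group_matrix ?G g (\<sigma> g)) = (\<Prod>g\<in>?Z. mpoly_var ((g - \<sigma> g) mod int n))"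
      by (intro prod.cong) auto
    then show ?thesis
      by (simp add: prod_mpoly_var differences_def)
  qed
  have "group_permanent ?G
      = (\<Sum>\<sigma> | \<sigma> permutes ?Z. Poly_Mapping.single (monomial_of_mset (differences (int n) \<sigma>)) 1)"
    unfolding group_permanent_def perm_on_def carrier
    by (intro sum.cong) (auto simp: entry)
  then have "Poly_Mapping.keys (group_permanent ?G)
      = monomial_of_mset ` differences (int n) ` {\<sigma>. \<sigma> permutes ?Z}"
    by (simp add: keys_sum_monomials finite_permutations image_image)
  then show ?thesis
    unfolding num_monomials_def
    by (simp add: card_image inj_on_subset[OF inj_monomial_of_mset])
qed

section \<open>Counting multisets of residues with sum zero\<close>

unbundle fps_syntax

definition complete_homogeneous :: "('a \<Rightarrow> 'b::comm_ring_1) \<Rightarrow> 'a set \<Rightarrow> nat \<Rightarrow> 'b" where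
  "complete_homogeneous w S m = (\<Sum>X\<in>multisets_of_size S m. \<Prod>i\<in>#X. w i)"

lemma complete_homogeneous_0 [simp]: "complete_homogeneous w S 0 = 1"
  by (simp add: complete_homogeneous_def)

text \<open>
  A multiset over \<open>insert a S\<close> either omits \<open>a\<close>, or it arises from a smaller multiset by adding one
  copy of \<open>a\<close>.
\<close>

lemma complete_homogeneous_insert_Suc:
  assumes "finite S" "a \<notin> S"
  shows "complete_homogeneous w (insert a S) (Suc m)
       = complete_homogeneous w S (Suc m) + w a * complete_homogeneous w (insert a S) m"
proof -
  have "multisets_of_size (insert a S) (Suc m)
      = multisets_of_size S (Suc m) \<union> add_mset a ` multisets_of_size (insert a S) m" (is "?L = ?R")
  proof (intro equalityI subsetI)
    fix X assume X: "X \<in> ?L"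
    show "X \<in> ?R"
    proof (cases "a \<in># X")
      case True
      then obtain Y where "X = add_mset a Y" by (metis insert_DiffM)
      then show ?thesis using X by (auto simp: multisets_of_size_def)
    qed (use X in \<open>auto simp: multisets_of_size_def\<close>)
  qed (auto simp: multisets_of_size_def)
  moreover have "multisets_of_size S (Suc m) \<inter> add_mset a ` multisets_of_size (insert a S) m = {}"
    using assms(2) by (auto simp: multisets_of_size_def)
  moreover have "inj_on (add_mset a) (multisets_of_size (insert a S) m)" by (simp add: inj_on_def)
  ultimately show ?thesis
    using assms(1) finite_multisets_of_size[of S] finite_multisets_of_size[of "insert a S"]
    by (simp add: complete_homogeneous_def sum.union_disjoint sum.reindex sum_distrib_left)
qed

text \<open>
  The generating function of the complete homogeneous symmetric polynomials is the reciprocal of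
  \<open>\<Prod>i. 1 - w i * X\<close>.
\<close>

lemma fps_complete_homogeneous:
  assumes "finite S"
  shows "(\<Prod>i\<in>S. 1 - fps_const (w i) * fps_X) * Abs_fps (complete_homogeneous w S) = 1"
  using assms
proof (induction S)
  case empty
  have "complete_homogeneous w {} m = (if m = 0 then 1 else 0)" for m
    by (cases m) (simp_all add: complete_homogeneous_def)
  then show ?case by (simp add: fps_eq_iff)
next
  case (insert a S)
  have "(1 - fps_const (w a) * fps_X) * Abs_fps (complete_homogeneous w (insert a S))
      = Abs_fps (complete_homogeneous w S)"
  proof (rule fps_ext)
    fix m
    show "((1 - fps_const (w a) * fps_X) * Abs_fps (complete_homogeneous w (insert a S))) $ m
      = Abs_fps (complete_homogeneous w S) $ m"
      using insert complete_homogeneous_insert_Suc[of S a w]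
      by (cases m) (simp_all add: algebra_simps)
  qed
  then have "(\<Prod>i\<in>S. 1 - fps_const (w i) * fps_X) *
      ((1 - fps_const (w a) * fps_X) * Abs_fps (complete_homogeneous w (insert a S))) = 1"
    using insert by simp
  then show ?case by (simp only: prod.insert[OF insert.hyps] mult_ac)
qed

definition primitive_root_unity :: "nat \<Rightarrow> 'a::field \<Rightarrow> bool" where
  "primitive_root_unity d z \<longleftrightarrow> (\<forall>k. z ^ k = 1 \<longleftrightarrow> d dvd k)"

text \<open>
  Replacing \<open>X\<close> by \<open>z * X\<close> permutes the factors cyclically, so only the powers of \<open>X\<close> whose exponent is
  divisible by \<open>d\<close> can occur. The degree leaves a constant term \<open>1\<close> and a multiple of \<open>X ^ d\<close>, and the
  root \<open>X = 1\<close> fixes the latter.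
\<close>

lemma prod_primitive_root_unity_poly:
  fixes z :: "'a::field"
  assumes "primitive_root_unity d z" "d > 0"
  shows "(\<Prod>i<d. [:1, - (z ^ i):]) = 1 - monom 1 d"
proof -
  let ?f = "\<lambda>i. [:1, - (z ^ i):]"
  define P where "P = (\<Prod>i<d. ?f i)"
  have zd: "z ^ d = 1" using assms by (simp add: primitive_root_unity_def)
  have "pcompose P [:0, z:] = (\<Prod>i<d. ?f (Suc i))"
    by (simp add: P_def pcompose_prod pcompose_pCons mult.commute)
  moreover have "?f 0 * (\<Prod>i<d. ?f (Suc i)) = ?f 0 * P"
    using prod.lessThan_Suc[of ?f d] prod.lessThan_Suc_shift[of ?f d] zd by (simp add: P_def)
  ultimately have "pcompose P [:0, z:] = P"
    by (simp only: mult_cancel_left) simp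
  then have inv: "z ^ k * coeff P k = coeff P k" for k
    by (metis coeff_pcompose_linear)
  have "degree P \<le> (\<Sum>i<d. degree (?f i))"
    using degree_prod_sum_le[of "{..<d}" ?f] by (simp add: P_def o_def)
  also have "\<dots> \<le> (\<Sum>i<d. 1)" by (rule sum_mono) simp
  finally have deg: "degree P \<le> d" by simp
  have c0: "coeff P 0 = 1" by (simp add: P_def poly_prod flip: poly_0_coeff_0)
  have P: "P = 1 + monom (coeff P d) d"
  proof (rule poly_eqI)
    fix k
    show "coeff P k = coeff (1 + monom (coeff P d) d) k"
    proof (cases "k = 0 \<or> k = d")
      case False
      have "coeff P k = 0"
      proof (cases "k < d")
        case True
        then have "z ^ k \<noteq> 1" using False assms(1) by (auto simp: primitive_root_unity_def dest: dvd_imp_le)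
        then show ?thesis using inv[of k] by simp
      qed (use deg False in \<open>simp add: coeff_eq_0\<close>)
      then show ?thesis using False by (simp add: coeff_1)
    qed (use c0 assms(2) in \<open>auto simp: coeff_1\<close>)
  qed
  have "poly P 1 = 0"
    unfolding P_def poly_prod using assms(2) by (intro prod_zero) (auto intro!: bexI[of _ 0])
  then have "1 + coeff P d = 0" by (subst (asm) P) (simp add: poly_monom)
  then have "coeff P d = - 1" by (simp add: add_eq_0_iff)
  then show ?thesis using P by (simp add: P_def minus_monom)
qed

lemma prod_primitive_root_unity_fps:
  fixes z :: "'a::field"
  assumes "primitive_root_unity d z" "d > 0"
  shows "(\<Prod>i<e * d. 1 - fps_const (z ^ i) * fps_X) = (1 - fps_X ^ d) ^ e"
proof -
  let ?f = "\<lambda>i. 1 - fps_const (z ^ i) * fps_X"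
  have linear: "fps_of_poly [:1, - (z ^ i):] = ?f i" for i
    by (simp add: fps_of_poly_pCons)
  then have "(\<Prod>i<d. ?f i) = fps_of_poly (\<Prod>i<d. [:1, - (z ^ i):])"
    by (simp only: fps_of_poly_prod linear)
  also have "\<dots> = 1 - fps_X ^ d"
    by (subst prod_primitive_root_unity_poly[OF assms]) (simp add: fps_of_poly_diff fps_of_poly_monom)
  finally have *: "(\<Prod>i<d. ?f i) = 1 - fps_X ^ d" .
  have "(\<Prod>i<e * d. ?f i) = (\<Prod>m<e. \<Prod>i\<in>{m * d..<m * d + d}. ?f i)"
    by (rule prod.nat_group [symmetric])
  also have "\<dots> = (\<Prod>m<e. \<Prod>i<d. ?f i)"
  proof (rule prod.cong)
    fix m
    have "z ^ (m * d) = 1" using assms(1) by (simp add: primitive_root_unity_def)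
    then show "(\<Prod>i\<in>{m * d..<m * d + d}. ?f i) = (\<Prod>i<d. ?f i)"
      using prod.shift_bounds_nat_ivl[of ?f 0 "m * d" d] by (simp add: power_add add.commute atLeast0LessThan)
  qed simp
  finally show ?thesis by (simp add: *)
qed

text \<open>
  At a primitive \<open>d\<close>-th root of unity the generating function is \<open>(1 - X ^ d) ^ (- e)\<close>, that is, the
  binomial series for exponent \<open>- e\<close> evaluated at \<open>X ^ d\<close>.
\<close>

lemma complete_homogeneous_primitive_root_unity:
  fixes z :: "'a::field_char_0"
  assumes "primitive_root_unity d z" "d > 0" "e > 0"
  shows "complete_homogeneous (\<lambda>i. z ^ i) {..<e * d} (e * d) = of_nat ((2 * e - 1) choose (e - 1))"
proof -
  let ?F = "Abs_fps (\<lambda>k. of_nat ((e + k - 1) choose k)) :: 'a fps"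
  let ?H = "Abs_fps (complete_homogeneous (\<lambda>i. z ^ i) {..<e * d})"
  have H: "(1 - fps_X ^ d) ^ e * ?H = 1"
    using fps_complete_homogeneous[of "{..<e * d}" "\<lambda>i. z ^ i"] prod_primitive_root_unity_fps[OF assms(1,2)]
    by simp
  have "inverse ((1 - fps_X :: 'a fps) ^ e) = ?F"
    using one_minus_const_fps_X_neg_power'[OF assms(3), of "1::'a"] by simp
  moreover have "((1 - fps_X :: 'a fps) ^ e) $ 0 \<noteq> 0" by (simp add: fps_power_zeroth)
  ultimately have "(1 - fps_X) ^ e * ?F = 1"
    by (metis inverse_mult_eq_1')
  then have "((1 - fps_X) ^ e * ?F) oo fps_X ^ d = 1" by simp
  moreover have "(1 - fps_X :: 'a fps) ^ e oo fps_X ^ d = (1 - fps_X ^ d) ^ e"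
    using assms(2) by (simp add: fps_compose_sub_distrib flip: fps_compose_power)
  ultimately have "(1 - fps_X ^ d) ^ e * (?F oo fps_X ^ d) = 1"
    using assms(2) by (simp add: fps_compose_mult_distrib)
  with H have "(1 - fps_X ^ d) ^ e * ?H = (1 - fps_X ^ d) ^ e * (?F oo fps_X ^ d)" by simp
  moreover have "(1 - fps_X ^ d) ^ e \<noteq> (0 :: 'a fps)" using H by (metis mult_zero_left zero_neq_one)
  ultimately have "?H = ?F oo fps_X ^ d" by (simp only: mult_cancel_left) simp
  then have "?H $ (e * d) = (?F oo fps_X ^ d) $ (e * d)" by simp
  also have "\<dots> = (\<Sum>i\<in>{0..e * d}. if i = e then ?F $ e else 0)"
    unfolding fps_compose_nth
    using assms(2) by (intro sum.cong refl) (auto simp flip: power_mult)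
  also have "\<dots> = ?F $ e" using assms(2) by simp
  also have "\<dots> = of_nat ((2 * e - 1) choose e)" by (simp add: mult_2)
  also have "(2 * e - 1) choose e = (2 * e - 1) choose (e - 1)"
    using binomial_symmetric[of e "2 * e - 1"] assms(3) by simp
  finally show ?thesis by simp
qed

lemma primitive_root_unity_cis:
  assumes "n > 0"
  shows "primitive_root_unity n (cis (2 * pi / real n))"
  unfolding primitive_root_unity_def
proof
  fix k
  let ?w = "cis (2 * pi / real n)"
  have pow: "?w ^ j = cis (2 * pi * real j / real n)" for j by (simp add: DeMoivre mult_ac)
  have n: "?w ^ n = 1" using assms by (simp add: pow)
  have "?w ^ k = ?w ^ (k mod n + n * (k div n))" by simp
  also have "\<dots> = ?w ^ (k mod n)" unfolding power_add power_mult n by simp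
  finally have "?w ^ k = ?w ^ (k mod n)" .
  moreover have "?w ^ (k mod n) = ?w ^ 0 \<longleftrightarrow> k mod n = 0"
    using inj_on_eq_iff[OF bij_betw_imp_inj_on[OF bij_betw_roots_unity[OF assms]], of "k mod n" 0] assms
    by (simp only: pow) simp
  ultimately show "?w ^ k = 1 \<longleftrightarrow> n dvd k" by (simp add: dvd_eq_mod_eq_0)
qed

lemma primitive_root_unity_power:
  assumes "primitive_root_unity n z" "n > 0"
  shows "primitive_root_unity (n div gcd j n) (z ^ j)"
proof -
  have "n dvd j * k \<longleftrightarrow> n div gcd j n dvd k" for k
  proof -
    define g where "g = gcd j n"
    have g: "g > 0" using assms(2) by (simp add: g_def)
    obtain a b where ab: "j = g * a" "n = g * b" by (metis g_def gcd_dvd1 gcd_dvd2 dvdE)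
    have "coprime a b"
      using ab g by (metis g_def gcd_mult_distrib_nat mult_cancel1 mult.right_neutral coprime_iff_gcd_eq_1 less_irrefl)
    then show ?thesis
      unfolding g_def[symmetric] using g by (simp add: ab mult.assoc coprime_dvd_mult_right_iff coprime_commute)
  qed
  then show ?thesis
    using assms(1) by (simp add: primitive_root_unity_def flip: power_mult)
qed

text \<open>
  The powers with exponents in \<open>{1..n}\<close> run through all \<open>n\<close>-th roots of unity. In this range Euler's
  function counts the exponents that have a given gcd with \<open>n\<close>.
\<close>

lemma sum_powers_primitive_root_unity:
  fixes z :: "'a::field"
  assumes "primitive_root_unity n z"
  shows "(\<Sum>j=1..n. (z ^ j) ^ s) = (if n dvd s then of_nat n else 0)"
proof (cases "n dvd s")
  case True
  then have "(z ^ j) ^ s = 1" for j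
    using assms by (simp add: primitive_root_unity_def flip: power_mult)
  then show ?thesis using True by simp
next
  case False
  define x where "x = z ^ s"
  have x: "x \<noteq> 1" using False assms by (simp add: x_def primitive_root_unity_def)
  have "x ^ n = 1" using assms by (simp add: x_def primitive_root_unity_def flip: power_mult)
  have "(\<Sum>j=1..n. (z ^ j) ^ s) = (\<Sum>j=1..n. x ^ j)"
    by (simp add: x_def mult.commute flip: power_mult)
  also have "\<dots> = (\<Sum>j<n. x ^ Suc j)" by (rule sum_bounds_lt_plus1 [symmetric])
  also have "\<dots> = x * (\<Sum>j<n. x ^ j)" by (simp add: sum_distrib_left)
  also have "\<dots> = 0" using geometric_sum[OF x, of n] \<open>x ^ n = 1\<close> by simp
  finally show ?thesis using False by simp
qed

text \<open>
  The condition \<open>n dvd \<Sum>\<^sub># X\<close> is detected by averaging \<open>(z ^ j) ^ (\<Sum>\<^sub># X)\<close> over all \<open>n\<close>-th roots of unity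
  \<open>z ^ j\<close>. For fixed \<open>j\<close> the sum over all \<open>X\<close> is a complete homogeneous polynomial at the powers of \<open>z ^ j\<close>,
  and \<open>z ^ j\<close> has order \<open>n div gcd j n\<close>.
\<close>

theorem card_zero_sum_multisets:
  assumes "n > 0"
  shows "n * card {X \<in> multisets_of_size {..<n} n. n dvd \<Sum>\<^sub># X}
       = (\<Sum>j=1..n. (2 * gcd j n - 1) choose (gcd j n - 1))"
proof -
  define z where "z = cis (2 * pi / real n)"
  have z: "primitive_root_unity n z"
    unfolding z_def by (rule primitive_root_unity_cis[OF assms])
  let ?M = "multisets_of_size {..<n} n"
  have fin: "finite ?M" by (rule finite_multisets_of_size) simp
  have prod: "(\<Prod>i\<in>#X. (z ^ j) ^ i) = (z ^ j) ^ (\<Sum>\<^sub># X)" for X j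
    by (induction X) (simp_all add: power_add)
  have "of_nat (n * card {X \<in> ?M. n dvd \<Sum>\<^sub># X}) = (\<Sum>X\<in>?M. if n dvd \<Sum>\<^sub># X then of_nat n else (0::complex))"
    using fin by (simp add: sum.If_cases Int_def)
  also have "\<dots> = (\<Sum>X\<in>?M. \<Sum>j=1..n. (z ^ j) ^ (\<Sum>\<^sub># X))"
    by (simp only: sum_powers_primitive_root_unity[OF z])
  also have "\<dots> = (\<Sum>j=1..n. complete_homogeneous (\<lambda>i. (z ^ j) ^ i) {..<n} n)"
    unfolding complete_homogeneous_def prod by (rule sum.swap)
  also have "\<dots> = (\<Sum>j=1..n. of_nat ((2 * gcd j n - 1) choose (gcd j n - 1)))"
  proof (rule sum.cong)
    fix j
    have "primitive_root_unity (n div gcd j n) (z ^ j)"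
      using primitive_root_unity_power[OF z assms] .
    from complete_homogeneous_primitive_root_unity[OF this, of "gcd j n"]
    show "complete_homogeneous (\<lambda>i. (z ^ j) ^ i) {..<n} n = of_nat ((2 * gcd j n - 1) choose (gcd j n - 1))"
      using assms by (simp add: div_greater_zero_iff)
  qed simp
  also have "\<dots> = of_nat (\<Sum>j=1..n. (2 * gcd j n - 1) choose (gcd j n - 1))" by simp
  finally show ?thesis by (simp only: of_nat_eq_iff)
qed

lemma sum_gcd_prime_power:
  assumes "prime p"
  shows "(\<Sum>j=1..p ^ N. f (gcd j (p ^ N))) = (\<Sum>k\<le>N. of_nat (totient (p ^ (N - k))) * (f (p ^ k) :: 'a::comm_semiring_1))"
proof -
  let ?n = "p ^ N"
  have p: "p > 1" using assms by (rule prime_gt_1_nat)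
  have "(\<Sum>j=1..?n. f (gcd j ?n)) = (\<Sum>d\<in>(\<lambda>k. p ^ k) ` {..N}. \<Sum>j | j \<in> {1..?n} \<and> gcd j ?n = d. f (gcd j ?n))"
  proof (rule sum.group [symmetric])
    show "(\<lambda>j. gcd j ?n) ` {1..?n} \<subseteq> (\<lambda>k. p ^ k) ` {..N}"
      using divides_primepow_nat[OF assms, of _ N] by auto
  qed auto
  also have "\<dots> = (\<Sum>k\<le>N. \<Sum>j | j \<in> {1..?n} \<and> gcd j ?n = p ^ k. f (gcd j ?n))"
    using p by (subst sum.reindex) (auto simp: inj_on_def)
  also have "\<dots> = (\<Sum>k\<le>N. of_nat (totient (p ^ (N - k))) * f (p ^ k))"
  proof (rule sum.cong)
    fix k assume k: "k \<in> {..N}"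
    have "{1..?n} = {0<..?n}" by auto
    then have "card {j \<in> {1..?n}. gcd j ?n = p ^ k} = totient (?n div p ^ k)"
      using card_gcd_eq_totient[of ?n "p ^ k"] p k by (simp add: le_imp_power_dvd)
    also have "?n div p ^ k = p ^ (N - k)" using p k by (simp add: power_diff)
    finally show "(\<Sum>j | j \<in> {1..?n} \<and> gcd j ?n = p ^ k. f (gcd j ?n)) = of_nat (totient (p ^ (N - k))) * f (p ^ k)"
      by simp
  qed simp
  finally show ?thesis .
qed

text \<open>
  Hall's theorem speaks of residues as integers, the counting formula of residues as natural numbers.
\<close>

lemma card_zero_sum_multisets_int:
  "card {B \<in> multisets_of_size {0..<int n} n. [\<Sum>\<^sub># B = 0] (mod int n)}
     = card {X \<in> multisets_of_size {..<n} n. n dvd \<Sum>\<^sub># X}"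
proof -
  have sum: "\<Sum>\<^sub># (image_mset int X) = int (\<Sum>\<^sub># X)" for X
    by (induction X) auto
  have inv: "image_mset int (image_mset nat B) = B" if "set_mset B \<subseteq> {0..<int n}" for B
  proof -
    have "image_mset (int \<circ> nat) B = image_mset id B" using that by (intro image_mset_cong) auto
    then show ?thesis by (simp add: multiset.map_comp multiset.map_id0)
  qed
  have "bij_betw (image_mset int) {X \<in> multisets_of_size {..<n} n. n dvd \<Sum>\<^sub># X}
      {B \<in> multisets_of_size {0..<int n} n. [\<Sum>\<^sub># B = 0] (mod int n)}" (is "bij_betw _ ?N ?I")
  proof (rule bij_betw_byWitness[where f' = "image_mset nat"])
    show "\<forall>X\<in>?N. image_mset nat (image_mset int X) = X" by (simp add: multiset.map_comp o_def)
    show "\<forall>B\<in>?I. image_mset int (image_mset nat B) = B" using inv by (simp add: multisets_of_size_def)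
    show "image_mset int ` ?N \<subseteq> ?I"
    proof (rule image_subsetI)
      fix X assume X: "X \<in> ?N"
      then have "int n dvd \<Sum>\<^sub># (image_mset int X)"
        unfolding sum by (simp only: mem_Collect_eq of_nat_dvd_iff)
      then show "image_mset int X \<in> ?I"
        using X by (auto simp: multisets_of_size_def cong_0_iff simp del: of_nat_sum_mset)
    qed
    show "image_mset nat ` ?I \<subseteq> ?N"
    proof (rule image_subsetI)
      fix B assume B: "B \<in> ?I"
      then have "\<Sum>\<^sub># B = int (\<Sum>\<^sub># (image_mset nat B))"
        using inv[of B] sum[of "image_mset nat B"] unfolding multisets_of_size_def by fastforce
      moreover have "int n dvd \<Sum>\<^sub># B" using B by (simp add: cong_0_iff)
      ultimately have "n dvd \<Sum>\<^sub># (image_mset nat B)" by (metis of_nat_dvd_iff)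
      moreover have "nat x < n" if "x \<in># B" for x
        using B that by (fastforce simp: multisets_of_size_def)
      ultimately show "image_mset nat B \<in> ?N"
        using B by (auto simp: multisets_of_size_def)
    qed
  qed
  then show ?thesis by (simp add: bij_betw_same_card)
qed

section \<open>Wolstenholme's congruence for prime powers\<close>

definition reduced_residues :: "int \<Rightarrow> int set" where
  "reduced_residues q = {j \<in> {0..<q}. coprime j q}"

lemma finite_reduced_residues [simp]: "finite (reduced_residues q)"
  by (rule finite_subset[of _ "{0..<q}"]) (auto simp: reduced_residues_def)

text \<open>
  Multiplication by a unit permutes the units modulo \<open>q\<close>, here represented by integers in \<open>{0..<q}\<close>.
\<close>

lemma bij_betw_reduced_residues_mult:
  assumes "coprime a q" "q > 0"
  shows "bij_betw (\<lambda>j. (a * j) mod q) (reduced_residues q) (reduced_residues q)"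
proof (rule bij_betwI')
  fix x y assume xy: "x \<in> reduced_residues q" "y \<in> reduced_residues q"
  have "(a * x) mod q = (a * y) mod q \<longleftrightarrow> [x = y] (mod q)"
    using cong_mult_lcancel[OF assms(1)] by (simp add: cong_def)
  also have "\<dots> \<longleftrightarrow> x = y"
    using xy by (auto simp: cong_def reduced_residues_def)
  finally show "(a * x) mod q = (a * y) mod q \<longleftrightarrow> x = y" .
next
  fix x assume "x \<in> reduced_residues q"
  then show "(a * x) mod q \<in> reduced_residues q"
    using assms by (auto simp: reduced_residues_def)
next
  fix y assume y: "y \<in> reduced_residues q"
  obtain b where b: "[a * b = 1] (mod q)" using cong_solve_coprime_int[OF assms(1)] by auto
  then have "coprime b q"
    by (metis cong_imp_coprime cong_sym coprime_1_left coprime_mult_left_iff)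
  then have "(b * y) mod q \<in> reduced_residues q"
    using y assms by (auto simp: reduced_residues_def)
  moreover have "y = (a * ((b * y) mod q)) mod q"
  proof -
    have "[a * b * y = 1 * y] (mod q)" using b by (intro cong_mult) auto
    then show ?thesis using y by (simp add: cong_def mod_simps mult.assoc reduced_residues_def)
  qed
  ultimately show "\<exists>x\<in>reduced_residues q. y = (a * x) mod q" by blast
qed

text \<open>
  Doubling permutes the units, so the sum \<open>S\<close> of their squares satisfies \<open>S = 4 * S\<close> modulo \<open>q\<close>; then
  \<open>3 * S = 0\<close>, and \<open>3\<close> is invertible.
\<close>

lemma sum_squares_reduced_residues:
  assumes "coprime 6 q" "q > 0"
  shows "[(\<Sum>j\<in>reduced_residues q. j\<^sup>2) = 0] (mod q)"
proof -
  let ?S = "\<Sum>j\<in>reduced_residues q. j\<^sup>2"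
  have "coprime (2 * 3) q" using assms by simp
  then have cop: "coprime 2 q" "coprime 3 q" by (simp_all only: coprime_mult_left_iff)
  have "?S = (\<Sum>j\<in>reduced_residues q. ((2 * j) mod q)\<^sup>2)"
    by (rule sum.reindex_bij_betw [OF bij_betw_reduced_residues_mult, symmetric]) (use assms cop in auto)
  also have "[\<dots> = (\<Sum>j\<in>reduced_residues q. (2 * j)\<^sup>2)] (mod q)"
    by (intro cong_sum cong_pow) (simp add: cong_def)
  also have "(\<Sum>j\<in>reduced_residues q. (2 * j)\<^sup>2) = 4 * ?S"
    by (simp add: sum_distrib_left power_mult_distrib)
  finally have "q dvd 3 * ?S"
    by (simp add: cong_iff_dvd_diff)
  then show ?thesis
    using cop(2) by (simp add: cong_0_iff coprime_commute coprime_dvd_mult_right_iff)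
qed

text \<open>
  Inversion permutes the units, so the inverse squares have the same sum as the squares.
\<close>

lemma sum_inverse_squares_reduced_residues:
  assumes "coprime 6 q" "q > 0"
  obtains w where "\<And>j. j \<in> reduced_residues q \<Longrightarrow> [j * w j = 1] (mod q)"
    and "[(\<Sum>j\<in>reduced_residues q. (w j)\<^sup>2) = 0] (mod q)"
proof -
  let ?U = "reduced_residues q"
  have "\<exists>w. w \<in> ?U \<and> [j * w = 1] (mod q)" if "j \<in> ?U" for j
  proof -
    have j: "coprime j q" using that by (simp add: reduced_residues_def)
    obtain b where b: "[j * b = 1] (mod q)" using cong_solve_coprime_int[OF j] by auto
    then have "coprime b q"
      by (metis cong_imp_coprime cong_sym coprime_1_left coprime_mult_left_iff)
    then have "b mod q \<in> ?U" using assms by (simp add: reduced_residues_def)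
    moreover have "[j * (b mod q) = 1] (mod q)" using b by (simp add: cong_def mod_simps)
    ultimately show ?thesis by blast
  qed
  then obtain w where w: "\<And>j. j \<in> ?U \<Longrightarrow> w j \<in> ?U" "\<And>j. j \<in> ?U \<Longrightarrow> [j * w j = 1] (mod q)"
    by metis
  have "inj_on w ?U"
  proof (rule inj_onI)
    fix i j assume ij: "i \<in> ?U" "j \<in> ?U" "w i = w j"
    have "[i * 1 = i * (j * w j)] (mod q)" using w(2)[OF ij(2)] by (intro cong_mult) (auto simp: cong_sym)
    also have "i * (j * w j) = (i * w i) * j" using ij by simp
    also have "[\<dots> = 1 * j] (mod q)" using w(2)[OF ij(1)] by (intro cong_mult) auto
    finally show "i = j" using ij by (simp add: cong_def reduced_residues_def)
  qed
  moreover have "w ` ?U \<subseteq> ?U" using w(1) by blast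
  ultimately have "bij_betw w ?U ?U"
    unfolding bij_betw_def using endo_inj_surj finite_reduced_residues by blast
  then have "(\<Sum>j\<in>?U. (w j)\<^sup>2) = (\<Sum>j\<in>?U. j\<^sup>2)"
    by (rule sum.reindex_bij_betw)
  then have "[(\<Sum>j\<in>?U. (w j)\<^sup>2) = 0] (mod q)"
    using sum_squares_reduced_residues[OF assms] by simp
  with w(2) show thesis by (rule that)
qed

text \<open>
  To first order in \<open>t\<close> a product of factors \<open>1 + t * f j\<close> is linear.
\<close>

lemma prod_one_plus_cong:
  fixes t m :: int
  assumes "finite S" "m dvd t * t"
  shows "[(\<Prod>j\<in>S. 1 + t * f j) = 1 + t * (\<Sum>j\<in>S. f j)] (mod m)"
  using assms(1)
proof (induction S)
  case (insert x S)
  have "[(1 + t * f x) * (\<Prod>j\<in>S. 1 + t * f j) = (1 + t * f x) * (1 + t * (\<Sum>j\<in>S. f j))] (mod m)"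
    using insert by (intro cong_mult) auto
  also have "(1 + t * f x) * (1 + t * (\<Sum>j\<in>S. f j))
      = (1 + t * (f x + (\<Sum>j\<in>S. f j))) + t * t * (f x * (\<Sum>j\<in>S. f j))"
    by (simp add: algebra_simps)
  also have "[\<dots> = (1 + t * (f x + (\<Sum>j\<in>S. f j))) + 0] (mod m)"
    using assms(2) by (intro cong_add) (auto simp: cong_0_iff)
  finally show ?case using insert by simp
qed simp

text \<open>
  Write \<open>A\<close> for the shifted product and \<open>B\<close> for the product of the units. A first-order expansion of \<open>A\<close>
  would only give a congruence modulo \<open>q\<^sup>2\<close>. Pairing \<open>j\<close> with \<open>q - j\<close> removes the linear term:
  \<open>(q + j) * (2 * q - j) = j * (q - j) + 2 * q\<^sup>2\<close>. Hence \<open>A\<^sup>2\<close> equals \<open>B\<^sup>2\<close> times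
  \<open>\<Prod>j. 1 + 2 * q\<^sup>2 / (j * (q - j))\<close>, and modulo \<open>q\<^sup>3\<close> the correction is \<open>- 2 * q\<^sup>2\<close> times the sum of the
  inverse squares, which vanishes. Working with squares avoids choosing one element of each pair; the
  square root is harmless because \<open>A + B = 2 * B\<close> modulo \<open>q\<close>, a unit.
\<close>

lemma prod_shifted_reduced_residues_cong:
  fixes q :: int
  assumes "coprime 6 q" "q > 1"
  shows "[(\<Prod>j\<in>reduced_residues q. q + j) = (\<Prod>j\<in>reduced_residues q. j)] (mod q ^ 3)"
proof -
  let ?U = "reduced_residues q"
  define A where "A = (\<Prod>j\<in>?U. q + j)"
  define B where "B = (\<Prod>j\<in>?U. j)"
  obtain w where w: "\<And>j. j \<in> ?U \<Longrightarrow> [j * w j = 1] (mod q)"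
    and sum_w: "[(\<Sum>j\<in>?U. (w j)\<^sup>2) = 0] (mod q)"
    using sum_inverse_squares_reduced_residues[OF assms(1)] assms(2) by auto
  have reflect: "bij_betw (\<lambda>j. q - j) ?U ?U"
  proof (rule bij_betw_byWitness[where f' = "\<lambda>j. q - j"])
    have "q - j \<in> ?U" if "j \<in> ?U" for j
    proof -
      have j: "0 \<le> j" "j < q" "coprime j q" using that by (auto simp: reduced_residues_def)
      then have "j \<noteq> 0" using assms by auto
      moreover have "coprime (q - j) q"
        using j(3) by (metis coprime_commute coprime_diff_one_left gcd_diff1 coprime_iff_gcd_eq_1 gcd.commute gcd_diff2)
      ultimately show ?thesis using j by (simp add: reduced_residues_def)
    qed
    then show "(\<lambda>j. q - j) ` ?U \<subseteq> ?U" "(\<lambda>j. q - j) ` ?U \<subseteq> ?U" by blast+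
  qed auto
  have A': "A = (\<Prod>j\<in>?U. 2 * q - j)"
    unfolding A_def by (subst prod.reindex_bij_betw[OF reflect, symmetric]) (simp add: algebra_simps)
  have B': "B = (\<Prod>j\<in>?U. q - j)"
    unfolding B_def by (subst prod.reindex_bij_betw[OF reflect, symmetric]) simp
  have "A * A = (\<Prod>j\<in>?U. (q + j) * (2 * q - j))"
    by (subst (2) A', subst A_def) (simp add: prod.distrib)
  also have "[\<dots> = (\<Prod>j\<in>?U. (j * (q - j)) * (1 + 2 * q\<^sup>2 * (- (w j)\<^sup>2)))] (mod q ^ 3)"
  proof (rule cong_prod)
    fix j assume "j \<in> ?U"
    have "[(j * w j) * (j * w j) = 1 * 1] (mod q)"
      using w[OF \<open>j \<in> ?U\<close>] by (intro cong_mult)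
    then have "q dvd 1 - (j * w j) * (j * w j)" by (simp add: cong_iff_dvd_diff dvd_diff_commute)
    then have "q dvd 1 - (j * w j) * (j * w j) + q * (j * (w j)\<^sup>2)" by (intro dvd_add) auto
    then have "q\<^sup>2 * q dvd 2 * q\<^sup>2 * (1 - (j * w j) * (j * w j) + q * (j * (w j)\<^sup>2))"
      by (intro mult_dvd_mono) auto
    also have "2 * q\<^sup>2 * (1 - (j * w j) * (j * w j) + q * (j * (w j)\<^sup>2))
       = (q + j) * (2 * q - j) - (j * (q - j)) * (1 + 2 * q\<^sup>2 * (- (w j)\<^sup>2))"
      by (simp add: algebra_simps power2_eq_square)
    finally show "[(q + j) * (2 * q - j) = (j * (q - j)) * (1 + 2 * q\<^sup>2 * (- (w j)\<^sup>2))] (mod q ^ 3)"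
      by (simp add: cong_iff_dvd_diff power3_eq_cube power2_eq_square)
  qed
  also have "(\<Prod>j\<in>?U. (j * (q - j)) * (1 + 2 * q\<^sup>2 * (- (w j)\<^sup>2)))
      = (B * B) * (\<Prod>j\<in>?U. 1 + 2 * q\<^sup>2 * (- (w j)\<^sup>2))"
    by (subst (2) B', subst B_def) (simp add: prod.distrib)
  also have "[\<dots> = (B * B) * (1 + 2 * q\<^sup>2 * (\<Sum>j\<in>?U. - (w j)\<^sup>2))] (mod q ^ 3)"
    by (intro cong_mult cong_refl prod_one_plus_cong)
       (auto simp: power3_eq_cube power2_eq_square)
  also have "[(B * B) * (1 + 2 * q\<^sup>2 * (\<Sum>j\<in>?U. - (w j)\<^sup>2)) = (B * B) * (1 + 0)] (mod q ^ 3)"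
  proof -
    have "q dvd (\<Sum>j\<in>?U. - (w j)\<^sup>2)" using sum_w by (simp add: cong_0_iff sum_negf)
    then have "q\<^sup>2 * q dvd 2 * q\<^sup>2 * (\<Sum>j\<in>?U. - (w j)\<^sup>2)" by (intro mult_dvd_mono) auto
    then have "[2 * q\<^sup>2 * (\<Sum>j\<in>?U. - (w j)\<^sup>2) = 0] (mod q ^ 3)"
      by (simp add: cong_0_iff power3_eq_cube power2_eq_square)
    then show ?thesis by (intro cong_mult cong_add cong_refl)
  qed
  finally have "q ^ 3 dvd (A - B) * (A + B)"
    by (simp add: cong_iff_dvd_diff algebra_simps)
  moreover have "coprime (q ^ 3) (A + B)"
  proof -
    have "[A = B] (mod q)"
      unfolding A_def B_def by (intro cong_prod) (simp add: cong_def)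
    then have "[A + B = B + B] (mod q)" by (intro cong_add) auto
    then have "[2 * B = A + B] (mod q)" by (simp add: cong_sym_eq)
    moreover have "coprime (2 * B) q"
    proof -
      have "coprime (2 * 3) q" using assms by simp
      then have "coprime 2 q" by (simp only: coprime_mult_left_iff)
      moreover have "coprime B q"
        unfolding B_def by (rule prod_coprime_left) (simp add: reduced_residues_def)
      ultimately show ?thesis by simp
    qed
    ultimately have "coprime (A + B) q" by (rule cong_imp_coprime)
    then show ?thesis by (simp add: coprime_commute)
  qed
  ultimately have "q ^ 3 dvd A - B" by (simp add: coprime_dvd_mult_left_iff)
  then show ?thesis by (simp add: cong_iff_dvd_diff A_def B_def)
qed

lemma prod_shift_eq_central_binomial:
  assumes "q > 0"
  shows "(\<Prod>j\<in>{1..<q}. q + j) = ((2 * q - 1) choose (q - 1)) * (\<Prod>j\<in>{1..<q}. j)"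
proof -
  have *: "fact q * (\<Prod>j\<in>{1..<Suc m}. q + j) = (fact (q + m) :: nat)" for m
    by (induction m) (simp_all add: prod.atLeastLessThan_Suc algebra_simps)
  have q: "Suc (q - 1) = q" using assms by simp
  have f: "fact (q - 1) = (\<Prod>j\<in>{1..<q}. j)"
  proof -
    have "{1..q - 1} = {1..<q}" by auto
    then show ?thesis by (simp add: fact_prod)
  qed
  have "fact q * (\<Prod>j\<in>{1..<q}. q + j) = (fact (2 * q - 1) :: nat)"
    using *[of "q - 1"] q assms by (simp add: mult_2)
  also have "\<dots> = fact (q - 1) * fact (2 * q - 1 - (q - 1)) * ((2 * q - 1) choose (q - 1))"
    by (subst binomial_fact_lemma) (use assms in auto)
  also have "2 * q - 1 - (q - 1) = q" using assms by simp
  finally have "fact q * (\<Prod>j\<in>{1..<q}. q + j)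
      = fact q * (((2 * q - 1) choose (q - 1)) * (\<Prod>j\<in>{1..<q}. j))"
    by (simp only: f ac_simps)
  then show ?thesis by (simp only: mult_cancel1 fact_nonzero) simp
qed

text \<open>
  The binomial coefficient for \<open>q = p ^ Suc k\<close> is the product of \<open>(q + j) / j\<close> over \<open>1 \<le> j < q\<close>. In the
  factors with \<open>j = p * i\<close> a \<open>p\<close> cancels, and they form the same product for \<open>q / p = p ^ k\<close>.
\<close>

lemma central_binomial_prime_power_step:
  assumes "prime p"
  shows "((2 * p ^ Suc k - 1) choose (p ^ Suc k - 1)) * (\<Prod>j | j \<in> {1..<p ^ Suc k} \<and> \<not> p dvd j. j)
       = ((2 * p ^ k - 1) choose (p ^ k - 1)) * (\<Prod>j | j \<in> {1..<p ^ Suc k} \<and> \<not> p dvd j. p ^ Suc k + j)"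
proof -
  let ?q = "p ^ Suc k" and ?r = "p ^ k"
  let ?U = "{j \<in> {1..<?q}. \<not> p dvd j}"
  have p: "p > 0" using assms prime_gt_0_nat by blast
  have multiples: "{1..<?q} = ?U \<union> (*) p ` {1..<?r}"
  proof (intro equalityI subsetI)
    fix j assume j: "j \<in> {1..<?q}"
    show "j \<in> ?U \<union> (*) p ` {1..<?r}"
    proof (cases "p dvd j")
      case True
      then obtain i where "j = p * i" by blast
      then show ?thesis using j p by auto
    qed (use j in auto)
  qed (use p in auto)
  have split: "(\<Prod>j\<in>{1..<?q}. f j) = (\<Prod>j\<in>?U. f j) * (\<Prod>j\<in>{1..<?r}. f (p * j))" for f :: "nat \<Rightarrow> nat"
  proof -
    have "(\<Prod>j\<in>{1..<?q}. f j) = (\<Prod>j\<in>?U. f j) * (\<Prod>j\<in>(*) p ` {1..<?r}. f j)"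
      by (subst multiples, rule prod.union_disjoint) auto
    also have "(\<Prod>j\<in>(*) p ` {1..<?r}. f j) = (\<Prod>j\<in>{1..<?r}. f (p * j))"
      using p by (subst prod.reindex) (auto simp: inj_on_def)
    finally show ?thesis .
  qed
  let ?C = "\<lambda>q. (2 * q - 1) choose (q - 1)"
  let ?P = "\<Prod>j\<in>{1..<?r}. p * j"
  have P: "?P \<noteq> 0" using p by simp
  have "?C ?q * (\<Prod>j\<in>?U. j) * ?P = (\<Prod>j\<in>{1..<?q}. ?q + j)"
    using split[of "\<lambda>j. j"] prod_shift_eq_central_binomial[of ?q] p by (simp add: algebra_simps)
  also have "\<dots> = (\<Prod>j\<in>?U. ?q + j) * (\<Prod>j\<in>{1..<?r}. p * (?r + j))"
    using split[of "\<lambda>j. ?q + j"] by (simp add: algebra_simps)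
  also have "(\<Prod>j\<in>{1..<?r}. p * (?r + j)) = ?C ?r * ?P"
    using prod_shift_eq_central_binomial[of ?r] p by (simp only: prod.distrib) (simp add: algebra_simps)
  finally have "(?C ?q * (\<Prod>j\<in>?U. j)) * ?P = (?C ?r * (\<Prod>j\<in>?U. ?q + j)) * ?P"
    by (simp only: ac_simps)
  then show ?thesis using P by (simp only: mult_cancel2) simp
qed

text \<open>
  Together the two previous results give the generalisation of Wolstenholme's theorem to prime powers;
  \<open>k = 0\<close> is Wolstenholme's theorem itself, because the right-hand side is then \<open>1\<close>.
\<close>

theorem central_binomial_prime_power_cong:
  assumes "prime p" "p \<ge> 5"
  shows "[(2 * p ^ Suc k - 1) choose (p ^ Suc k - 1) = (2 * p ^ k - 1) choose (p ^ k - 1)] (mod (p ^ Suc k) ^ 3)"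
proof -
  let ?q = "p ^ Suc k"
  let ?U = "{j \<in> {1..<?q}. \<not> p dvd j}"
  let ?C = "\<lambda>q. (2 * q - 1) choose (q - 1)"
  have cop: "coprime (p ^ Suc k) j \<longleftrightarrow> \<not> p dvd j" for j
  proof -
    have "coprime p j \<longleftrightarrow> \<not> p dvd j"
      using assms(1) by (meson coprime_absorb_left not_prime_unit prime_imp_coprime)
    then show ?thesis by (simp only: coprime_power_left_iff) simp
  qed
  have "\<not> p dvd 2 * 3"
  proof
    assume "p dvd 2 * 3"
    then have "p dvd 2 \<or> p dvd 3" using assms(1) prime_dvd_mult_iff by blast
    then show False using assms(2) by (auto dest: dvd_imp_le)
  qed
  then have "coprime 6 ?q" using cop[of 6] by (simp add: coprime_commute)
  then have c6: "coprime 6 (int ?q)" by (metis coprime_int_iff of_nat_numeral)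
  have "1 < p ^ Suc k" using assms by (intro one_less_power) auto
  then have q1: "int ?q > 1" by linarith
  have U: "reduced_residues (int ?q) = int ` ?U"
  proof (intro equalityI subsetI)
    fix x assume x: "x \<in> reduced_residues (int ?q)"
    then obtain j where j: "x = int j" "j < ?q" by (metis atLeastLessThan_iff mem_Collect_eq reduced_residues_def zero_le_imp_eq_int of_nat_less_iff)
    then have "coprime ?q j" using x by (simp add: reduced_residues_def coprime_commute flip: coprime_int_iff)
    then have "\<not> p dvd j" using cop by blast
    moreover then have "j \<noteq> 0" by (metis dvd_0_right)
    ultimately show "x \<in> int ` ?U" using j by auto
  next
    fix x assume "x \<in> int ` ?U"
    then obtain j where j: "x = int j" "j < ?q" "\<not> p dvd j" by auto
    then have "coprime j ?q" using cop coprime_commute by blast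
    then have "coprime x (int ?q)" using j by (metis coprime_int_iff)
    moreover have "x < int ?q" using j(1,2) by (simp only: of_nat_less_iff)
    ultimately show "x \<in> reduced_residues (int ?q)" using j(1) by (simp add: reduced_residues_def)
  qed
  have "[int (\<Prod>j\<in>?U. ?q + j) = int (\<Prod>j\<in>?U. j)] (mod int (?q ^ 3))"
    using prod_shifted_reduced_residues_cong[OF c6 q1]
    unfolding U by (simp add: prod.reindex)
  then have AB: "[(\<Prod>j\<in>?U. ?q + j) = (\<Prod>j\<in>?U. j)] (mod ?q ^ 3)"
    by (simp only: cong_int_iff)
  have "[?C ?q * (\<Prod>j\<in>?U. j) = ?C (p ^ k) * (\<Prod>j\<in>?U. j)] (mod ?q ^ 3)"
    using central_binomial_prime_power_step[OF assms(1), of k] cong_mult[OF cong_refl AB, of "?C (p ^ k)"]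
    by simp
  moreover have "coprime (\<Prod>j\<in>?U. j) (?q ^ 3)"
    using cop by (intro prod_coprime_left) (auto simp: coprime_commute)
  ultimately show ?thesis
    by (simp only: cong_mult_rcancel_nat)
qed

section \<open>The number of monomials modulo a power of the prime\<close>

text \<open>
  Summation by parts, with \<open>totient (p ^ m) = p ^ m - p ^ (m - 1)\<close> for \<open>m > 0\<close>.
\<close>

lemma sum_totient_prime_power:
  fixes c :: "nat \<Rightarrow> int"
  assumes "prime p"
  shows "(\<Sum>k\<le>N. int (totient (p ^ (N - k))) * c k)
       = int p ^ N * c 0 + (\<Sum>k<N. int p ^ (N - Suc k) * (c (Suc k) - c k))"
proof -
  have tot: "int (totient (p ^ (N - k))) = int p ^ (N - k) - int p ^ (N - Suc k)" if "k < N" for k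
  proof -
    have Suc: "N - k = Suc (N - Suc k)" using that by simp
    have "p \<ge> 1" using assms prime_ge_1_nat by blast
    then show ?thesis
      unfolding Suc using totient_prime_power_Suc[OF assms, of "N - Suc k"]
      by (simp add: algebra_simps of_nat_diff)
  qed
  have "(\<Sum>k\<le>N. int (totient (p ^ (N - k))) * c k)
      = (\<Sum>k<N. (int p ^ (N - k) - int p ^ (N - Suc k)) * c k) + c N"
    using tot by (simp add: lessThan_Suc_atMost[symmetric])
  also have "\<dots> = (\<Sum>k\<le>N. int p ^ (N - k) * c k) - (\<Sum>k<N. int p ^ (N - Suc k) * c k)"
    by (simp add: left_diff_distrib sum_subtractf lessThan_Suc_atMost[symmetric])
  also have "(\<Sum>k\<le>N. int p ^ (N - k) * c k) = int p ^ N * c 0 + (\<Sum>k<N. int p ^ (N - Suc k) * c (Suc k))"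
    by (simp add: sum.atMost_shift)
  finally show ?thesis by (simp add: right_diff_distrib sum_subtractf)
qed

text \<open>
  Divided by \<open>p ^ N\<close>, the right-hand side is the sum of the quotients \<open>(c (Suc k) - c k) / p ^ Suc k\<close>
  for \<open>k < N\<close>. The initial value \<open>c 0 = 1\<close> accounts for the \<open>- 1\<close> on the left.
\<close>

theorem num_monomials_group_permanent_prime_power:
  fixes N :: nat
  assumes "prime p"
  defines "c \<equiv> \<lambda>k. int ((2 * p ^ k - 1) choose (p ^ k - 1))"
  shows "int p ^ N * (int (num_monomials (group_permanent (integer_mod_group (p ^ N)))) - 1)
       = (\<Sum>k<N. int p ^ (N - Suc k) * (c (Suc k) - c k))"
proof -
  let ?n = "p ^ N"
  let ?f = "\<lambda>g. int ((2 * g - 1) choose (g - 1))"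
  have n: "?n > 0" using assms(1) prime_gt_0_nat by simp
  have "num_monomials (group_permanent (integer_mod_group ?n))
      = card {X \<in> multisets_of_size {..<?n} ?n. ?n dvd \<Sum>\<^sub># X}"
    using Hall_differences[of "int ?n"] n
    by (simp only: num_monomials_group_permanent_cyclic[OF n] of_nat_0_less_iff nat_int
        card_zero_sum_multisets_int simp_thms)
  then have "?n * num_monomials (group_permanent (integer_mod_group ?n))
      = (\<Sum>j=1..?n. (2 * gcd j ?n - 1) choose (gcd j ?n - 1))"
    using card_zero_sum_multisets[OF n] by simp
  then have "int ?n * int (num_monomials (group_permanent (integer_mod_group ?n))) = (\<Sum>j=1..?n. ?f (gcd j ?n))"
    by (metis (mono_tags, lifting) of_nat_mult of_nat_sum sum.cong)
  also have "\<dots> = (\<Sum>k\<le>N. int (totient (p ^ (N - k))) * c k)"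
    unfolding c_def by (rule sum_gcd_prime_power[OF assms(1)])
  also have "\<dots> = int p ^ N * c 0 + (\<Sum>k<N. int p ^ (N - Suc k) * (c (Suc k) - c k))"
    by (rule sum_totient_prime_power[OF assms(1)])
  finally show ?thesis by (simp add: c_def algebra_simps)
qed

text \<open>
  The difference \<open>c (Suc k) - c k\<close> is divisible by \<open>p ^ (3 * Suc k)\<close>, so the summand with index \<open>k\<close> of the
  previous formula contributes a multiple of \<open>p ^ (2 * Suc k)\<close>. Modulo \<open>p ^ 4\<close> only \<open>k = 0\<close> survives, and
  it contributes \<open>(c 1 - 1) / p\<close>.
\<close>

lemma num_monomials_group_permanent_mod_p4:
  assumes "prime p" "p \<ge> 5" "N \<ge> 1"
  obtains e where "int ((2 * p - 1) choose (p - 1)) - 1 = int p ^ 3 * e"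
    and "[int (num_monomials (group_permanent (integer_mod_group (p ^ N)))) - 1 = int p ^ 2 * e] (mod int p ^ 4)"
proof -
  define c where "c = (\<lambda>k. int ((2 * p ^ k - 1) choose (p ^ k - 1)))"
  let ?Z = "int (num_monomials (group_permanent (integer_mod_group (p ^ N))))"
  have "\<exists>e. c (Suc k) - c k = int p ^ (3 * Suc k) * e" for k
  proof -
    have "[c (Suc k) = c k] (mod int ((p ^ Suc k) ^ 3))"
      unfolding c_def cong_int_iff by (rule central_binomial_prime_power_cong[OF assms(1,2)])
    then have "int ((p ^ Suc k) ^ 3) dvd c (Suc k) - c k" by (simp only: cong_iff_dvd_diff)
    moreover have "int ((p ^ Suc k) ^ 3) = int p ^ (3 * Suc k)"
      by (simp only: of_nat_power power_mult[symmetric] mult.commute)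
    ultimately show ?thesis by (auto elim!: dvdE)
  qed
  then obtain e where e: "\<And>k. c (Suc k) - c k = int p ^ (3 * Suc k) * e k" by metis
  have p: "int p \<noteq> 0" using assms(2) by simp
  have "int p ^ N * (?Z - 1) = (\<Sum>k<N. int p ^ (N - Suc k) * (c (Suc k) - c k))"
    unfolding c_def by (rule num_monomials_group_permanent_prime_power[OF assms(1)])
  also have "\<dots> = (\<Sum>k<N. int p ^ N * (int p ^ (2 * Suc k) * e k))"
  proof (rule sum.cong)
    fix k assume "k \<in> {..<N}"
    then have exponents: "N - Suc k + 3 * Suc k = N + 2 * Suc k" by simp
    then show "int p ^ (N - Suc k) * (c (Suc k) - c k) = int p ^ N * (int p ^ (2 * Suc k) * e k)"
      by (simp only: e mult.assoc[symmetric] power_add[symmetric] exponents)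
  qed simp
  finally have "?Z - 1 = (\<Sum>k<N. int p ^ (2 * Suc k) * e k)"
    using p by (simp only: sum_distrib_left[symmetric]) simp
  moreover obtain M where "N = Suc M" using assms(3) by (cases N) auto
  ultimately have "?Z - 1 = int p ^ 2 * e 0 + (\<Sum>k<M. int p ^ (2 * Suc (Suc k)) * e (Suc k))"
    by (simp only: sum.lessThan_Suc_shift) simp
  moreover have "int p ^ 4 dvd (\<Sum>k<M. int p ^ (2 * Suc (Suc k)) * e (Suc k))"
    by (intro dvd_sum dvd_mult2 le_imp_power_dvd) simp
  ultimately have "[?Z - 1 = int p ^ 2 * e 0] (mod int p ^ 4)"
    by (simp only: cong_iff_dvd_diff) simp
  moreover have "int ((2 * p - 1) choose (p - 1)) - 1 = int p ^ 3 * e 0"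
    using e[of 0] by (simp add: c_def)
  ultimately show thesis by (rule that[rotated])
qed

theorem corollary1p8:
  fixes p N :: nat
  assumes "prime p" and "p \<ge> 5" and "N \<ge> 1"
  shows "(\<exists>k :: int. real_of_int k = 1 / real p * (real ((2 * p - 1) choose (p - 1)) - 1) \<and>
           [int (num_monomials (group_permanent (integer_mod_group (p ^ N)))) - 1 = k] (mod (int p ^ 3)))
       \<and> ([num_monomials (group_permanent (integer_mod_group (p ^ N))) = 1] (mod p ^ 3)
           \<longleftrightarrow> wolstenholme_prime p)"
proof -
  let ?Z = "num_monomials (group_permanent (integer_mod_group (p ^ N)))"
  let ?c = "(2 * p - 1) choose (p - 1)"
  have p: "int p \<noteq> 0" using assms(2) by simp
  obtain e where e: "int ?c - 1 = int p ^ 3 * e" and Z4: "[int ?Z - 1 = int p ^ 2 * e] (mod int p ^ 4)"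
    using num_monomials_group_permanent_mod_p4[OF assms] by blast
  have Z: "[int ?Z - 1 = int p ^ 2 * e] (mod int p ^ 3)"
    by (rule cong_dvd_modulus[OF Z4]) (simp add: le_imp_power_dvd)
  have "real ?c - 1 = real_of_int (int ?c - 1)" by simp
  also have "\<dots> = real_of_int (int p ^ 3 * e)" by (simp only: e)
  also have "\<dots> = real p * real_of_int (int p ^ 2 * e)"
    by (simp add: power3_eq_cube power2_eq_square)
  finally have quotient: "real_of_int (int p ^ 2 * e) = 1 / real p * (real ?c - 1)"
    using p by simp
  have "[?Z = 1] (mod p ^ 3) \<longleftrightarrow> [int ?Z = 1] (mod int p ^ 3)"
    by (metis cong_int_iff of_nat_1 of_nat_power)
  also have "\<dots> \<longleftrightarrow> [int ?Z - 1 = 0] (mod int p ^ 3)"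
    by (simp add: cong_iff_dvd_diff)
  also have "\<dots> \<longleftrightarrow> [int p ^ 2 * e = 0] (mod int p ^ 3)"
    using Z cong_sym cong_trans by blast
  also have "\<dots> \<longleftrightarrow> int p dvd e"
    using p by (simp add: cong_0_iff power3_eq_cube power2_eq_square mult.assoc)
  also have "\<dots> \<longleftrightarrow> int p ^ 3 * int p dvd int p ^ 3 * e"
    using p by (simp only: dvd_mult_cancel_left) simp
  also have "\<dots> \<longleftrightarrow> [int ?c = int 1] (mod int (p ^ 4))"
  proof -
    have "int (p ^ 4) = int p ^ 3 * int p" by (simp add: power3_eq_cube power4_eq_xxxx)
    then show ?thesis by (simp only: cong_iff_dvd_diff e of_nat_1)
  qed
  also have "\<dots> \<longleftrightarrow> wolstenholme_prime p"
    using assms(1) by (simp only: cong_int_iff wolstenholme_prime_def) simp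
  finally show ?thesis using quotient Z by blast
qed

end
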